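(* Let the state space $\mathcal S$ (with metric $d$) and the action space $\mathcal A$ be non-empty Borel spaces. Let $\{\mathcal A(s)\}_{s\in\mathcal S}$ be a family of non-empty subsets of $\mathcal A$ such that $\mathrm K=\{(s,a):s\in\mathcal S,\ a\in\mathcal A(s)\}$ is an analytic subset of $\mathcal S\times\mathcal A$. For $t=1,\dots,T$ let $g_t$ be a lower semi-analytic function on $\mathrm K$ bounded from below. Let $\{\widehat{\mathbb P}(\cdot\mid s,a)\}_{(s,a)\in\mathrm K}$ be a Borel measurable stochastic kernel on $\mathcal S$ given $(s,a)$. Let $\rho$ be a positive lower semi-analytic function on $\mathrm K$, let $p\in[1,\infty)$, $c=d^p$, and define $$\mathfrak M(s,a)=\{\mathbb P\in\mathcal P(\mathcal S):\mathcal K_c(\widehat{\mathbb P}(\cdot\mid s,a),\mathbb P)\le\rho(s,a)\},\qquad(s,a)\in\mathrm K.$$ Define $V_{T+1}\equiv0$ and, for $t=T,\dots,1$, $$V_t(s)=\inf_{a\in\mathcal A(s)}\Big\{g_t(s,a)+\sup_{\mathbb P\in\mathfrak M(s,a)}\mathbb E_{s'\sim\mathbb P}[V_{t+1}(s')]\Big\},\qquad s\in\mathcal S.$$ Then for every $t=1,\dots,T$ and $s\in\mathcal S$, $$V_t(s)=\inf_{a\in\mathcal A(s),\ \lambda\ge0}\Big\{g_t(s,a)+\lambda\rho(s,a)+\mathbb E_{\hat s'\sim\widehat{\mathbb P}(\cdot\mid s,a)}\Big[\sup_{s'\in\mathcal S}\{V_{t+1}(s')-\lambda c(\hat s',s'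)\}\Big]\Big\}.$$
   Context: A Borel space is a Borel subset of a complete separable metric space (with the induced metric and Borel $\sigma$-algebra). An extended real-valued function $h$ on an analytic set $D$ is lower semi-analytic if $\{x\in D:h(x)<r\}$ is analytic for every $r\in\mathbb R$. $\mathcal P(\mathcal S)$ is the set of Borel probability measures on $\mathcal S$. The Kantorovich transport cost is $\mathcal K_c(\mathbb Q,\mathbb P)=\inf_\gamma\mathbb E_{(\hat s,s)\sim\gamma}[c(\hat s,s)]$, the infimum being over all probability measures $\gamma$ on $\mathcal S\times\mathcal S$ with marginals $\mathbb Q$ and $\mathbb P$. Integrals of functions that are only universally measurable (such as lower semi-analytic functions) are taken with respect to the completion of the measure. *)

theory Defs
  imports "HOL-Probability.Probability"
begin

text \<open>Analytic sets as continuous images of Baire space. The type \<open>nat \<Rightarrow> nat\<close> carries the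
  product topology of the discrete topology on \<open>nat\<close>. For a Borel subset \<open>X\<close> of a Polish space,
  the analytic subsets of \<open>X\<close> are exactly the analytic sets of the ambient space contained in \<open>X\<close>.\<close>

definition analytic_set :: "'a::topological_space set \<Rightarrow> bool" where
  "analytic_set A \<longleftrightarrow>
     A = {} \<or> (\<exists>f :: (nat \<Rightarrow> nat) \<Rightarrow> 'a. continuous_on UNIV f \<and> range f = A)"

definition lower_semianalytic_on ::
    "'a::topological_space set \<Rightarrow> ('a \<Rightarrow> ereal) \<Rightarrow> bool" where
  "lower_semianalytic_on D h \<longleftrightarrow>
     analytic_set D \<and> (\<forall>r::real. analytic_set {x \<in> D. h x < ereal r})"

definition borel_probs :: "'s::topological_space set \<Rightarrow> 's measure set" where
  "borel_probs S = {P. prob_space P \<and> sets P = sets (restrict_space borel S)}"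

text \<open>Positive part minus negative part: \<open>e2ennreal\<close> sends negative numbers to 0.
  If both parts are infinite the value is \<open>\<infinity>\<close>, but this cannot occur for integrands that are
  bounded from below by a real constant.\<close>

definition expect :: "'s measure \<Rightarrow> ('s \<Rightarrow> ereal) \<Rightarrow> ereal" where
  "expect P f =
     enn2ereal (\<integral>\<^sup>+ x. e2ennreal (f x) \<partial>completion P)
     - enn2ereal (\<integral>\<^sup>+ x. e2ennreal (- f x) \<partial>completion P)"

definition couplings ::
    "'s::topological_space set \<Rightarrow> 's measure \<Rightarrow> 's measure \<Rightarrow> ('s \<times> 's) measure set" where
  "couplings S Q P =
     {\<gamma>. prob_space \<gamma>
         \<and> sets \<gamma> = sets (restrict_space borel S \<Otimes>\<^sub>M restrict_space borel S)
         \<and> distr \<gamma> (restrict_space borel S) fst = Q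
         \<and> distr \<gamma> (restrict_space borel S) snd = P}"

text \<open>The cost \<open>c\<close> is meant to be nonnegative (\<open>ennreal\<close> truncates at 0).\<close>

definition kantorovich_cost ::
    "'s::topological_space set \<Rightarrow> ('s \<Rightarrow> 's \<Rightarrow> real) \<Rightarrow> 's measure \<Rightarrow> 's measure \<Rightarrow> ennreal" where
  "kantorovich_cost S c Q P =
     (INF \<gamma>\<in>couplings S Q P. \<integral>\<^sup>+ (s', s). ennreal (c s' s) \<partial>\<gamma>)"

definition ambiguity_set ::
    "'s::topological_space set \<Rightarrow> ('s \<Rightarrow> 's \<Rightarrow> real) \<Rightarrow> ('s \<times> 'a \<Rightarrow> 's measure)
      \<Rightarrow> ('s \<times> 'a \<Rightarrow> ereal) \<Rightarrow> 's \<times> 'a \<Rightarrow> 's measure set" where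
  "ambiguity_set S c Phat \<rho> x =
     {P \<in> borel_probs S. enn2ereal (kantorovich_cost S c (Phat x) P) \<le> \<rho> x}"

end

theory Submission
  imports Defs
begin

text \<open>The identity holds for each state-action pair separately. Fix \<open>V\<close> bounded from
  below and the reference measure \<open>Q\<close> and
  put \<open>\<Phi> l x = sup s. V s - l c(x, s)\<close>. As a supremum of functions continuous in \<open>x\<close> it is Borel.
  If a plan \<open>\<gamma>\<close> couples \<open>Q\<close> and \<open>P\<close>, then \<open>V \<le> W\<close> for the Borel function
  \<open>W s = inf x. \<Phi> l x + l c(x, s)\<close>, and integrating \<open>W s \<le> \<Phi> l x + l c(x, s)\<close> over \<open>\<gamma>\<close> bounds the
  expectation of \<open>V\<close> by the dual objective.

  Conversely, choose a sequence \<open>e\<close> in \<open>S\<close> along which the graph of \<open>V\<close> is dense. Then \<open>\<Phi> l\<close> is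
  the supremum over the points \<open>e i\<close> alone, so an almost optimal target is found by taking the least
  good index, and measurable selection theorems are not needed. The attainable
  pairs (cost, value) form a convex set; the slope \<open>l\<close> of a supporting line at \<open>\<rho>\<close> is
  the optimal multiplier.

  To avoid \<open>\<infinity> - \<infinity>\<close>, values are shifted by the lower bound \<open>- k\<close> and integrated in
  \<open>ennreal\<close>; the truncation of the subtraction there is harmless because \<open>s = x\<close> already gives a
  nonnegative term.\<close>

subsection \<open>Dense sequences in graphs\<close>

text \<open>Second countability of the product allows choosing one graph point in every basic open
  set that meets the graph. Density in the graph, and not merely in \<open>S\<close>, lets one
  sequence approximate points and values of an arbitrary \<open>F\<close> simultaneously.\<close>

lemma countable_dense_in_graph:
  fixes F :: "'a::second_countable_topology \<Rightarrow> 'b::second_countable_topology"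
  assumes "S \<noteq> {}"
  obtains e :: "nat \<Rightarrow> 'a"
  where "range e \<subseteq> S" "\<And>s. s \<in> S \<Longrightarrow> (s, F s) \<in> closure (range (\<lambda>i. (e i, F (e i))))"
proof -
  let ?G = "\<lambda>s. (s, F s)"
  obtain B :: "('a \<times> 'b) set set" where B: "countable B" "topological_basis B"
    using ex_countable_basis by blast
  define C where "C = (\<lambda>b. SOME s. s \<in> S \<and> ?G s \<in> b) ` {b \<in> B. \<exists>s\<in>S. ?G s \<in> b}"
  have sel: "(SOME s. s \<in> S \<and> ?G s \<in> b) \<in> S \<and> ?G (SOME s. s \<in> S \<and> ?G s \<in> b) \<in> b"
    if "\<exists>s\<in>S. ?G s \<in> b" for b
    using that by (metis (mono_tags, lifting) someI_ex)
  have dense: "?G s \<in> closure (?G ` C)" if "s \<in> S" for s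
    unfolding closure_iff_nhds_not_empty
  proof (intro allI impI)
    fix A V assume "V \<subseteq> A" "open V" "?G s \<in> V"
    then obtain b where b: "b \<in> B" "?G s \<in> b" "b \<subseteq> V"
      using topological_basisE[OF B(2)] by metis
    then have "b \<in> {b \<in> B. \<exists>s\<in>S. ?G s \<in> b}" using that by blast
    then have "(SOME s. s \<in> S \<and> ?G s \<in> b) \<in> C" unfolding C_def by blast
    moreover have "?G (SOME s. s \<in> S \<and> ?G s \<in> b) \<in> b" using sel b that by blast
    ultimately show "?G ` C \<inter> A \<noteq> {}" using b \<open>V \<subseteq> A\<close> by blast
  qed
  have C: "countable C" "C \<subseteq> S" using B sel unfolding C_def by auto
  have "C \<noteq> {}" using dense assms by fastforce
  then have r: "range (from_nat_into C) = C" using C by simp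
  show ?thesis
  proof (rule that[of "from_nat_into C"])
    show "range (from_nat_into C) \<subseteq> S" using r C by simp
    show "?G s \<in> closure (range (\<lambda>i. ?G (from_nat_into C i)))" if "s \<in> S" for s
      using dense[OF that] image_image[of ?G "from_nat_into C" UNIV] unfolding r by (rule back_subst)
  qed
qed

text \<open>The set where \<open>h\<close> stays below the countable supremum is closed and contains
  \<open>range G'\<close>, hence every \<open>G s\<close>. This turns suprema over \<open>S\<close>
  into countable ones, which preserve measurability.\<close>

lemma SUP_eq_SUP_dense:
  fixes h :: "'a::topological_space \<Rightarrow> 'b::{complete_linorder, linorder_topology}"
  assumes h: "continuous_on UNIV h"
    and G: "range G' \<subseteq> G ` S" "\<And>s. s \<in> S \<Longrightarrow> G s \<in> closure (range G')"
  shows "(SUP s\<in>S. h (G s)) = (SUP i. h (G' i))"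
proof (rule antisym)
  have "closed (h -` {..SUP i. h (G' i)})"
    using h by (simp add: closed_vimage continuous_on_closed_vimage)
  then have "closure (range G') \<subseteq> h -` {..SUP i. h (G' i)}"
    by (intro closure_minimal) (auto intro: SUP_upper)
  then show "(SUP s\<in>S. h (G s)) \<le> (SUP i. h (G' i))"
    using G by (intro SUP_least) auto
  show "(SUP i. h (G' i)) \<le> (SUP s\<in>S. h (G s))"
    using G(1) by (intro SUP_least) (metis SUP_upper imageE range_subsetD)
qed

lemma INF_eq_INF_dense:
  fixes h :: "'a::topological_space \<Rightarrow> 'b::{complete_linorder, linorder_topology}"
  assumes h: "continuous_on UNIV h"
    and G: "range G' \<subseteq> G ` S" "\<And>s. s \<in> S \<Longrightarrow> G s \<in> closure (range G')"
  shows "(INF s\<in>S. h (G s)) = (INF i. h (G' i))"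
proof (rule antisym)
  have "closed (h -` {INF i. h (G' i)..})"
    using h by (simp add: closed_vimage continuous_on_closed_vimage)
  then have "closure (range G') \<subseteq> h -` {INF i. h (G' i)..}"
    by (intro closure_minimal) (auto intro: INF_lower)
  then show "(INF i. h (G' i)) \<le> (INF s\<in>S. h (G s))"
    using G by (intro INF_greatest) auto
  show "(INF s\<in>S. h (G s)) \<le> (INF i. h (G' i))"
    using G(1) by (intro INF_greatest) (metis INF_lower imageE range_subsetD)
qed

subsection \<open>Expectations of functions bounded from below\<close>

lemma space_borel_probs:
  "P \<in> borel_probs S \<Longrightarrow> space P = S"
  unfolding borel_probs_def by (auto dest: sets_eq_imp_space_eq simp: space_restrict_space)

text \<open>\<open>nn_integral\<close> is a supremum over simple functions below the integrand, so
  it is monotone for arbitrary integrands; value functions can thus be compared with Borel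
  ones.\<close>

lemma expect_mono:
  assumes "\<And>x. x \<in> space P \<Longrightarrow> f x \<le> h x"
  shows "expect P f \<le> expect P h"
  unfolding expect_def nn_integral_completion
  using assms by (intro ereal_minus_mono)
    (auto simp flip: less_eq_ennreal.rep_eq intro!: nn_integral_mono e2ennreal_mono)

lemma expect_cong:
  assumes "\<And>x. x \<in> space P \<Longrightarrow> f x = h x"
  shows "expect P f = expect P h"
  by (intro antisym expect_mono) (simp_all add: assms)

text \<open>The negative part is at most \<open>k\<close>, so its integral is finite and can be
  cancelled from an additive identity between the two parts.\<close>

lemma expect_enn2ereal_minus:
  assumes P: "prob_space P" and h: "h \<in> borel_measurable P" and k: "0 \<le> k"
  shows "expect P (\<lambda>x. enn2ereal (h x) - ereal k) = enn2ereal (\<integral>\<^sup>+ x. h x \<partial>P) - ereal k"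
proof -
  interpret prob_space P by fact
  let ?f = "\<lambda>x. enn2ereal (h x) - ereal k"
  let ?p = "\<integral>\<^sup>+ x. e2ennreal (?f x) \<partial>P" and ?n = "\<integral>\<^sup>+ x. e2ennreal (- ?f x) \<partial>P"
  note h[measurable]
  \<comment> \<open>The splitting of \<open>?f\<close> into its parts, rearranged so that no
    subtraction occurs; it holds where \<open>h\<close> is infinite as well.\<close>
  have pt: "e2ennreal (?f x) + ennreal k = h x + e2ennreal (- ?f x)" for x
  proof (cases "h x")
    case (real r)
    then show ?thesis using k
      by (cases "r \<le> k") (auto simp: ennreal_neg simp flip: ennreal_plus)
  qed (simp add: e2ennreal_neg)
  have "?p + ennreal k = (\<integral>\<^sup>+ x. e2ennreal (?f x) + ennreal k \<partial>P)"
    by (subst nn_integral_add) (auto simp: emeasure_space_1)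
  also have "\<dots> = (\<integral>\<^sup>+ x. h x \<partial>P) + ?n"
    unfolding pt by (subst nn_integral_add) auto
  finally have eq: "?p + ennreal k = (\<integral>\<^sup>+ x. h x \<partial>P) + ?n" .
  have "?n \<le> (\<integral>\<^sup>+ x. ennreal k \<partial>P)"
  proof (rule nn_integral_mono)
    fix x
    have "- ?f x \<le> ereal k" by (cases "h x") auto
    then show "e2ennreal (- ?f x) \<le> ennreal k" by (metis e2ennreal_ereal e2ennreal_mono)
  qed
  then have "?n \<le> ennreal k" by (simp add: emeasure_space_1)
  then obtain n where n: "?n = ennreal n" "0 \<le> n" by (cases ?n) (auto simp: top_unique)
  have "enn2ereal a - ereal n = enn2ereal b - ereal k"
    if "a + ennreal k = b + ennreal n" for a b :: ennreal
    using that n(2) k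
    by (cases a; cases b) (simp_all flip: ennreal_plus)
  from this[OF eq[unfolded n(1)]] show ?thesis
    unfolding expect_def nn_integral_completion n(1) using n(2) by simp
qed

subsection \<open>Supporting lines of planar convex sets\<close>

text \<open>The slope \<open>l\<close> is a supergradient at \<open>\<rho>\<close> of the concave function whose hypograph is \<open>R\<close>.\<close>

lemma supergradient_exists:
  fixes R :: "(real \<times> real) set"
  assumes R: "convex R" and slater: "(r0, x0) \<in> R" "r0 < \<rho>"
    and bound: "\<And>r x. (r, x) \<in> R \<Longrightarrow> r \<le> \<rho> \<Longrightarrow> x \<le> v"
  obtains l where "0 \<le> l" "\<And>r x. (r, x) \<in> R \<Longrightarrow> x - l * r \<le> v - l * \<rho>"
proof -
  \<comment> \<open>Slopes of the lines joining points of \<open>R\<close> to the left of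
    \<open>\<rho>\<close> with \<open>(\<rho>, v)\<close>; their infimum is the
    supergradient.\<close>
  define Q where "Q = {(v - x) / (\<rho> - r) | r x. (r, x) \<in> R \<and> r < \<rho>}"
  have ne: "Q \<noteq> {}" using slater unfolding Q_def by blast
  have nn: "0 \<le> q" if "q \<in> Q" for q
    using that bound unfolding Q_def by (force simp: field_simps)
  then have bdd: "bdd_below Q" by (meson bdd_belowI)
  define l where "l = Inf Q"
  have "0 \<le> l" unfolding l_def using ne nn by (rule cInf_greatest)
  moreover have "x - l * r \<le> v - l * \<rho>" if rx: "(r, x) \<in> R" for r x
  proof (rule linorder_cases[of r \<rho>])
    assume r: "r < \<rho>"
    then have "(v - x) / (\<rho> - r) \<in> Q" using rx unfolding Q_def by blast
    then have "l \<le> (v - x) / (\<rho> - r)" unfolding l_def using bdd by (intro cInf_lower)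
    then show ?thesis using r by (simp add: field_simps)
  next
    assume "r = \<rho>" then show ?thesis using bound[OF rx] by simp
  next
    assume r: "\<rho> < r"
    \<comment> \<open>A chord from a point left of \<open>\<rho>\<close> to \<open>(r, x)\<close>
      stays in \<open>R\<close> and passes over \<open>\<rho>\<close> at height at most
      \<open>v\<close>. Hence the slope on the right is below every slope on the left.\<close>
    have "(x - v) / (r - \<rho>) \<le> q" if qQ: "q \<in> Q" for q
    proof -
      obtain r' x' where q: "q = (v - x') / (\<rho> - r')" "(r', x') \<in> R" "r' < \<rho>"
        using qQ by (auto simp: Q_def)
      \<comment> \<open>The weights for which the convex combination has first coordinate exactly
        \<open>\<rho>\<close>.\<close>
      let ?a = "(\<rho> - r') / (r - r')" and ?b = "(r - \<rho>) / (r - r')"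
      have "?a + ?b = (r - r') / (r - r')" by (simp flip: add_divide_distrib)
      then have ab: "?a + ?b = 1" "0 \<le> ?a" "0 \<le> ?b" using q r by simp_all
      have m: "?a *\<^sub>R (r, x) + ?b *\<^sub>R (r', x') \<in> R"
        using convexD[OF R rx q(2) ab(2,3,1)] .
      have "?a * r + ?b * r' = ((\<rho> - r') * r + (r - \<rho>) * r') / (r - r')"
        by (simp add: add_divide_distrib)
      also have "(\<rho> - r') * r + (r - \<rho>) * r' = \<rho> * (r - r')" by (simp add: algebra_simps)
      finally have e: "?a * r + ?b * r' = \<rho>" using q r by simp
      have "?a * x + ?b * x' \<le> v" using bound m e by simp
      then have "((\<rho> - r') * x + (r - \<rho>) * x') / (r - r') \<le> v" by (simp add: add_divide_distrib)
      then have "(\<rho> - r') * x + (r - \<rho>) * x' \<le> v * (r - r')" using q r by (simp add: divide_le_eq)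
      then have "(x - v) * (\<rho> - r') \<le> (v - x') * (r - \<rho>)" by (simp add: algebra_simps)
      moreover have "a / b \<le> c / d" if "a * d \<le> c * b" "0 < b" "0 < d" for a b c d :: real
        using that by (simp add: field_simps)
      ultimately show ?thesis unfolding q(1) using q r by simp
    qed
    then have "(x - v) / (r - \<rho>) \<le> l" unfolding l_def using ne by (intro cInf_greatest)
    then show ?thesis using r by (simp add: field_simps)
  qed
  ultimately show ?thesis by (rule that)
qed

subsection \<open>Transport duality for nonnegative functions\<close>

text \<open>\<open>U\<close> stands for the value function shifted up by its lower bound. Of
  \<open>d^p\<close> the cost keeps continuity, nonnegativity and vanishing on the diagonal.\<close>

locale transport =
  fixes S :: "'s::{second_countable_topology, t2_space} set"
    and Q :: "'s measure"
    and c :: "'s \<Rightarrow> 's \<Rightarrow> real"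
    and U :: "'s \<Rightarrow> ennreal"
  assumes prob_Q: "prob_space Q"
    and sets_Q[measurable_cong]: "sets Q = sets (restrict_space borel S)"
    and c_cont: "continuous_on UNIV (\<lambda>(x, y). c x y)"
    and c_nonneg: "\<And>x y. 0 \<le> c x y"
    and c_refl: "\<And>x. c x x = 0"
begin

sublocale Q: prob_space Q by (rule prob_Q)

abbreviation BS :: "'s measure" where "BS \<equiv> restrict_space borel S"

text \<open>The \<open>c\<close>-transform of \<open>U\<close> for the scaled cost
  \<open>l * c\<close>: the dual integrand up to the shift.\<close>

definition \<Theta> :: "real \<Rightarrow> 's \<Rightarrow> ennreal" where
  "\<Theta> l x = (SUP s\<in>S. U s - ennreal (l * c x s))"

definition cost :: "('s \<times> 's) measure \<Rightarrow> ennreal" where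
  "cost \<gamma> = (\<integral>\<^sup>+ (x, y). ennreal (c x y) \<partial>\<gamma>)"

text \<open>Couplings of \<open>Q\<close> with a free second marginal, so that the target measure is
  chosen along with the transport.\<close>

definition plans :: "('s \<times> 's) measure set" where
  "plans = {\<gamma>. prob_space \<gamma> \<and> sets \<gamma> = sets (BS \<Otimes>\<^sub>M BS) \<and> distr \<gamma> BS fst = Q}"

lemma space_BS: "space BS = S"
  by (simp add: space_restrict_space)

lemma space_Q: "space Q = S"
  using sets_eq_imp_space_eq[OF sets_Q] by (simp add: space_BS)

lemma S_nonempty: "S \<noteq> {}"
  using Q.not_empty space_Q by simp

lemma c_cont_left: "continuous_on UNIV (\<lambda>x. c x y)"
  by (rule continuous_on_compose2[OF c_cont, of _ "\<lambda>x. (x, y)", simplified]) (auto intro!: continuous_intros)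

lemma c_cont_right: "continuous_on UNIV (\<lambda>y. c x y)"
  by (rule continuous_on_compose2[OF c_cont, of _ "\<lambda>y. (x, y)", simplified]) (auto intro!: continuous_intros)

lemma id_measurable_BS: "(\<lambda>x. x) \<in> BS \<rightarrow>\<^sub>M borel"
  by (rule measurable_restrict_space1) simp

lemma c_measurable_left[measurable]: "(\<lambda>x. c x y) \<in> borel_measurable BS"
  by (intro measurable_restrict_space1 borel_measurable_continuous_onI c_cont_left)

lemma c_measurable_right[measurable]: "(\<lambda>y. c x y) \<in> borel_measurable BS"
  by (intro measurable_restrict_space1 borel_measurable_continuous_onI c_cont_right)

lemma c_measurable[measurable]: "(\<lambda>z. c (fst z) (snd z)) \<in> borel_measurable (BS \<Otimes>\<^sub>M BS)"
proof -
  have "(\<lambda>z. (fst z, snd z)) \<in> BS \<Otimes>\<^sub>M BS \<rightarrow>\<^sub>M borel \<Otimes>\<^sub>M borel"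
    by (intro measurable_Pair measurable_compose[OF measurable_fst id_measurable_BS]
        measurable_compose[OF measurable_snd id_measurable_BS])
  \<comment> \<open>Second countability identifies the product of the Borel algebras with the Borel
    algebra of the product.\<close>
  then have "(\<lambda>z. (fst z, snd z)) \<in> BS \<Otimes>\<^sub>M BS \<rightarrow>\<^sub>M borel"
    by (simp add: borel_prod)
  from measurable_compose[OF this borel_measurable_continuous_onI[OF c_cont]]
  show ?thesis by simp
qed

text \<open>The subtracted term is finite, which avoids the discontinuity of \<open>ennreal\<close>
  subtraction at two infinite arguments. Continuity is joint in point and value, as density in the
  graph requires.\<close>

lemma continuous_minus_cost:
  "continuous_on UNIV (\<lambda>z::'s \<times> ennreal. snd z - ennreal (l * c x (fst z)))"
proof -
  have "continuous_on UNIV (\<lambda>z::'s \<times> ennreal. c x (fst z))"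
    by (rule continuous_on_compose2[OF c_cont_right]) (auto intro!: continuous_intros)
  moreover have "continuous_on UNIV (snd :: 's \<times> ennreal \<Rightarrow> ennreal)"
    by (intro continuous_intros)
  ultimately show ?thesis
    unfolding continuous_on_def
    by (auto intro!: tendsto_diff_ennreal_general tendsto_ennrealI tendsto_intros)
qed

lemma continuous_plus_cost:
  "continuous_on UNIV (\<lambda>z::'s \<times> ennreal. snd z + ennreal (l * c (fst z) y))"
proof -
  have "continuous_on UNIV (\<lambda>z::'s \<times> ennreal. c (fst z) y)"
    by (rule continuous_on_compose2[OF c_cont_left]) (auto intro!: continuous_intros)
  then show ?thesis
    by (intro continuous_on_add_ennreal continuous_on_ennreal continuous_intros)
qed

lemma \<Theta>_eq_SUP_dense:
  assumes "range e \<subseteq> S" "\<And>s. s \<in> S \<Longrightarrow> (s, U s) \<in> closure (range (\<lambda>i. (e i, U (e i))))"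
  shows "\<Theta> l x = (SUP i::nat. U (e i) - ennreal (l * c x (e i)))"
  using SUP_eq_SUP_dense[OF continuous_minus_cost, of "\<lambda>i. (e i, U (e i))" "\<lambda>s. (s, U s)" S l x] assms
  by (auto simp: \<Theta>_def image_subset_iff)

lemma \<Theta>_measurable[measurable]: "\<Theta> l \<in> borel_measurable BS"
proof -
  obtain e :: "nat \<Rightarrow> 's" where e: "range e \<subseteq> S"
    "\<And>s. s \<in> S \<Longrightarrow> (s, U s) \<in> closure (range (\<lambda>i. (e i, U (e i))))"
    using countable_dense_in_graph[OF S_nonempty] by blast
  have "\<Theta> l = (\<lambda>x. SUP i. U (e i) - ennreal (l * c x (e i)))"
    using \<Theta>_eq_SUP_dense[OF e] by blast
  then show ?thesis by simp
qed

text \<open>Since \<open>W\<close> is an infimum of continuous functions, it is Borel even if \<open>U\<close> is not.\<close>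

lemma weak_duality:
  assumes \<gamma>: "\<gamma> \<in> couplings S Q P" and l: "0 \<le> l"
  obtains W where "W \<in> borel_measurable P" "\<And>s. s \<in> S \<Longrightarrow> U s \<le> W s"
    "(\<integral>\<^sup>+ s. W s \<partial>P) \<le> (\<integral>\<^sup>+ x. \<Theta> l x \<partial>Q) + ennreal l * cost \<gamma>"
proof -
  \<comment> \<open>Here the sequence is dense in the graph of \<open>\<Theta> l\<close>, because
    the infimum defining \<open>W\<close> runs over the source point.\<close>
  obtain e :: "nat \<Rightarrow> 's" where e: "range e \<subseteq> S"
    "\<And>s. s \<in> S \<Longrightarrow> (s, \<Theta> l s) \<in> closure (range (\<lambda>i. (e i, \<Theta> l (e i))))"
    using countable_dense_in_graph[OF S_nonempty] by blast
  define W where "W y = (INF i. \<Theta> l (e i) + ennreal (l * c (e i) y))" for y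
  have W_eq: "W y = (INF x\<in>S. \<Theta> l x + ennreal (l * c x y))" for y
    using INF_eq_INF_dense[OF continuous_plus_cost, of "\<lambda>i. (e i, \<Theta> l (e i))" "\<lambda>s. (s, \<Theta> l s)" S l y] e
    by (auto simp: W_def image_subset_iff)
  have W_meas[measurable]: "W \<in> borel_measurable BS"
    unfolding W_def by measurable
  have sets_\<gamma>[measurable_cong]: "sets \<gamma> = sets (BS \<Otimes>\<^sub>M BS)"
    and Q_eq: "distr \<gamma> BS fst = Q" and P_eq: "distr \<gamma> BS snd = P"
    using \<gamma> by (auto simp: couplings_def)
  have space_\<gamma>: "space \<gamma> = S \<times> S"
    using sets_eq_imp_space_eq[OF sets_\<gamma>] by (simp add: space_pair_measure space_BS)
  show ?thesis
  proof (rule that)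
    show "W \<in> borel_measurable P" using P_eq by auto
    show "U s \<le> W s" if "s \<in> S" for s
      unfolding W_eq
    proof (rule INF_greatest)
      fix x assume "x \<in> S"
      have "U s - ennreal (l * c x s) \<le> \<Theta> l x"
        unfolding \<Theta>_def using that by (rule SUP_upper)
      then show "U s \<le> \<Theta> l x + ennreal (l * c x s)"
        by (simp add: ennreal_minus_le_iff add.commute)
    qed
    have "(\<integral>\<^sup>+ s. W s \<partial>P) = (\<integral>\<^sup>+ z. W (snd z) \<partial>\<gamma>)"
      by (subst P_eq[symmetric], subst nn_integral_distr) auto
    also have "\<dots> \<le> (\<integral>\<^sup>+ z. \<Theta> l (fst z) + ennreal l * ennreal (c (fst z) (snd z)) \<partial>\<gamma>)"
    proof (rule nn_integral_mono)
      fix z assume "z \<in> space \<gamma>"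
      then have "fst z \<in> S" by (auto simp: space_\<gamma>)
      then show "W (snd z) \<le> \<Theta> l (fst z) + ennreal l * ennreal (c (fst z) (snd z))"
        unfolding W_eq using l c_nonneg by (auto intro: INF_lower simp flip: ennreal_mult)
    qed
    also have "\<dots> = (\<integral>\<^sup>+ z. \<Theta> l (fst z) \<partial>\<gamma>) + ennreal l * cost \<gamma>"
      unfolding cost_def case_prod_beta
      by (subst nn_integral_add, measurable, subst nn_integral_cmult) auto
    also have "(\<integral>\<^sup>+ z. \<Theta> l (fst z) \<partial>\<gamma>) = (\<integral>\<^sup>+ x. \<Theta> l x \<partial>Q)"
      by (subst Q_eq[symmetric], subst nn_integral_distr) auto
    finally show "(\<integral>\<^sup>+ s. W s \<partial>P) \<le> (\<integral>\<^sup>+ x. \<Theta> l x \<partial>Q) + ennreal l * cost \<gamma>" .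
  qed
qed

section \<open>Construction of transport plans\<close>

text \<open>A Bernoulli variable with parameter \<open>a\<close> decides which of the two plans to
  follow; both have first marginal \<open>Q\<close>, so the mixture does too. This gives convexity
  of the attainable pairs.\<close>

lemma mixture_plan:
  assumes \<gamma>: "\<gamma>1 \<in> plans" "\<gamma>2 \<in> plans" and ab: "0 \<le> a" "0 \<le> b" "a + b = 1"
  obtains \<gamma> where "\<gamma> \<in> plans"
    "\<And>f. f \<in> borel_measurable (BS \<Otimes>\<^sub>M BS) \<Longrightarrow>
      (\<integral>\<^sup>+ z. f z \<partial>\<gamma>) = ennreal a * (\<integral>\<^sup>+ z. f z \<partial>\<gamma>1) + ennreal b * (\<integral>\<^sup>+ z. f z \<partial>\<gamma>2)"
proof -
  let ?p = "measure_pmf (bernoulli_pmf a)"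
  let ?N = "\<lambda>t. if t then \<gamma>1 else \<gamma>2"
  let ?\<gamma> = "?p \<bind> ?N"
  have b: "b = 1 - a" "a \<le> 1" using ab by auto
  have N[measurable]: "?N \<in> ?p \<rightarrow>\<^sub>M subprob_algebra (BS \<Otimes>\<^sub>M BS)"
    using \<gamma> by (auto simp: plans_def space_subprob_algebra prob_space_imp_subprob_space)
  have int: "(\<integral>\<^sup>+ z. f z \<partial>?\<gamma>) = ennreal a * (\<integral>\<^sup>+ z. f z \<partial>\<gamma>1) + ennreal b * (\<integral>\<^sup>+ z. f z \<partial>\<gamma>2)"
    if "f \<in> borel_measurable (BS \<Otimes>\<^sub>M BS)" for f
    using ab b by (simp add: nn_integral_bind[OF that N] mult.commute)
  have sets_\<gamma>[measurable_cong]: "sets ?\<gamma> = sets (BS \<Otimes>\<^sub>M BS)"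
    using \<gamma> by (intro sets_bind) (auto simp: plans_def)
  have "prob_space ?\<gamma>"
    using \<gamma> by (intro measure_pmf.prob_space_bind[OF _ N]) (auto simp: plans_def)
  moreover have "distr ?\<gamma> BS fst = Q"
  proof (rule measure_eqI)
    fix A assume "A \<in> sets (distr ?\<gamma> BS fst)"
    then have A[measurable]: "A \<in> sets BS" by simp
    have marg: "(\<integral>\<^sup>+ z. indicator A (fst z) \<partial>\<gamma>') = emeasure Q A" if "\<gamma>' \<in> plans" for \<gamma>'
    proof -
      have [measurable_cong]: "sets \<gamma>' = sets (BS \<Otimes>\<^sub>M BS)" and Q_eq: "distr \<gamma>' BS fst = Q"
        using that by (auto simp: plans_def)
      have "emeasure Q A = (\<integral>\<^sup>+ x. indicator A x \<partial>distr \<gamma>' BS fst)"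
        using A by (subst Q_eq) (simp add: sets_Q)
      then show ?thesis by (subst (asm) nn_integral_distr) auto
    qed
    have "emeasure (distr ?\<gamma> BS fst) A = (\<integral>\<^sup>+ x. indicator A x \<partial>distr ?\<gamma> BS fst)"
      using A by simp
    also have "\<dots> = (\<integral>\<^sup>+ z. indicator A (fst z) \<partial>?\<gamma>)"
      by (subst nn_integral_distr) auto
    also have "\<dots> = (ennreal a + ennreal b) * emeasure Q A"
      by (subst int) (auto simp: marg \<gamma> distrib_right)
    also have "\<dots> = emeasure Q A"
      using ab by (simp flip: ennreal_plus)
    finally show "emeasure (distr ?\<gamma> BS fst) A = emeasure Q A" .
  qed (simp add: sets_Q)
  ultimately have "?\<gamma> \<in> plans" using sets_\<gamma> by (simp add: plans_def)
  then show ?thesis using int by (rule that)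
qed

text \<open>The plan is the law of \<open>(x, e (T x))\<close> under \<open>Q\<close>, where
  \<open>T x\<close> is the least index satisfying the pointwise condition. Integrating that
  condition yields both estimates.\<close>

lemma deterministic_plan:
  assumes e: "range (e :: nat \<Rightarrow> 's) \<subseteq> S"
    and f[measurable]: "f \<in> borel_measurable BS"
    and h[measurable]: "h \<in> borel_measurable BS" and l: "0 \<le> l"
    and sel: "\<And>x. x \<in> S \<Longrightarrow>
      \<exists>i. f x + ennreal (l * c x (e i)) \<le> h (e i) + ennreal d \<and> c x (e i) \<le> N"
  obtains \<gamma> where "\<gamma> \<in> plans" "cost \<gamma> \<le> ennreal N"
    "(\<integral>\<^sup>+ x. f x \<partial>Q) + ennreal l * cost \<gamma> \<le> (\<integral>\<^sup>+ z. h (snd z) \<partial>\<gamma>) + ennreal d"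
proof -
  define G where "G x i \<longleftrightarrow> f x + ennreal (l * c x (e i)) \<le> h (e i) + ennreal d \<and> c x (e i) \<le> N"
    for x i
  define T where "T x = (LEAST i. G x i)" for x
  have G: "G x (T x)" if "x \<in> S" for x
    unfolding T_def by (rule LeastI_ex) (use sel[OF that] in \<open>simp add: G_def\<close>)
  \<comment> \<open>The least index satisfying a countable family of measurable conditions is
    measurable.\<close>
  have T[measurable]: "T \<in> BS \<rightarrow>\<^sub>M count_space UNIV"
    unfolding T_def G_def by measurable
  have eS: "e i \<in> space BS" for i using e by (auto simp: space_BS)
  have [measurable]: "e \<in> count_space UNIV \<rightarrow>\<^sub>M BS"
    using eS by simp
  define m where "m x = (x, e (T x))" for x
  have m[measurable]: "m \<in> BS \<rightarrow>\<^sub>M BS \<Otimes>\<^sub>M BS"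
    unfolding m_def by measurable
  have m_Q: "m \<in> Q \<rightarrow>\<^sub>M BS \<Otimes>\<^sub>M BS" by measurable
  let ?\<gamma> = "distr Q (BS \<Otimes>\<^sub>M BS) m"
  have "distr ?\<gamma> BS fst = distr Q BS (\<lambda>x. x)"
    by (subst distr_distr) (auto simp: m_def comp_def)
  also have "\<dots> = Q" by (rule distr_id2) (simp add: sets_Q)
  finally have "?\<gamma> \<in> plans"
    by (simp add: plans_def Q.prob_space_distr[OF m_Q])
  moreover have cost: "cost ?\<gamma> = (\<integral>\<^sup>+ x. ennreal (c x (e (T x))) \<partial>Q)"
    unfolding cost_def case_prod_beta by (subst nn_integral_distr) (auto simp: m_def)
  have "cost ?\<gamma> \<le> (\<integral>\<^sup>+ x. ennreal N \<partial>Q)"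
    unfolding cost using G by (intro nn_integral_mono) (auto simp: G_def space_Q intro!: ennreal_leI)
  then have "cost ?\<gamma> \<le> ennreal N" by (simp add: Q.emeasure_space_1)
  moreover have "(\<integral>\<^sup>+ x. f x \<partial>Q) + ennreal l * cost ?\<gamma>
      = (\<integral>\<^sup>+ x. f x + ennreal (l * c x (e (T x))) \<partial>Q)"
    unfolding cost using l c_nonneg
    by (subst nn_integral_add) (auto simp: ennreal_mult simp flip: nn_integral_cmult intro!: measurable_compose[OF m_Q[unfolded m_def], of "\<lambda>z. ennreal (c (fst z) (snd z))", simplified])
  moreover have "\<dots> \<le> (\<integral>\<^sup>+ x. h (e (T x)) + ennreal d \<partial>Q)"
    using G by (intro nn_integral_mono) (auto simp: G_def space_Q)
  moreover have "\<dots> = (\<integral>\<^sup>+ x. h (e (T x)) \<partial>Q) + ennreal d"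
    by (subst nn_integral_add) (auto simp: Q.emeasure_space_1)
  moreover have "(\<integral>\<^sup>+ x. h (e (T x)) \<partial>Q) = (\<integral>\<^sup>+ z. h (snd z) \<partial>?\<gamma>)"
    by (subst nn_integral_distr) (auto simp: m_def)
  ultimately show ?thesis by (intro that) auto
qed

text \<open>Since \<open>c\<close> is continuous and vanishes on the diagonal, the points of cost
  below \<open>d\<close> form a neighbourhood of \<open>x\<close>. Such cheap targets serve as a
  fallback in selections and give the Slater point.\<close>

lemma near_point:
  assumes e: "\<And>s. s \<in> S \<Longrightarrow> (s, U s) \<in> closure (range (\<lambda>i::nat. (e i, U (e i))))"
    and x: "x \<in> S" and d: "0 < d"
  shows "\<exists>i. c x (e i) < d"
proof -
  have "open {z :: 's \<times> ennreal. c x (fst z) < d}"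
    by (intro open_Collect_less continuous_on_compose2[OF c_cont_right] continuous_intros) auto
  moreover have "(x, U x) \<in> {z. c x (fst z) < d}" using c_refl d by simp
  ultimately have "range (\<lambda>i. (e i, U (e i))) \<inter> {z. c x (fst z) < d} \<noteq> {}"
    using e[OF x] unfolding closure_iff_nhds_not_empty by blast
  then show ?thesis by auto
qed

text \<open>Truncating at \<open>n\<close> keeps both the transport cost and the value of a selection finite.\<close>

definition \<Theta>_trunc :: "real \<Rightarrow> (nat \<Rightarrow> 's) \<Rightarrow> nat \<Rightarrow> 's \<Rightarrow> ennreal" where
  "\<Theta>_trunc l e n x = (SUP i\<in>{..n}.
     if c x (e i) \<le> real n then min (U (e i)) (of_nat n) - ennreal (l * c x (e i)) else 0)"

lemma \<Theta>_trunc_measurable[measurable]: "\<Theta>_trunc l e n \<in> borel_measurable BS"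
  unfolding \<Theta>_trunc_def by measurable

lemma \<Theta>_trunc_le: "\<Theta>_trunc l e n x \<le> of_nat n"
  unfolding \<Theta>_trunc_def
  by (rule SUP_least) (auto simp: ennreal_minus_le_iff intro: min.coboundedI2 add_increasing)

lemma \<Theta>_trunc_mono: "incseq (\<Theta>_trunc l e)"
proof (intro monoI le_funI)
  fix m n x assume mn: "m \<le> (n::nat)"
  show "\<Theta>_trunc l e m x \<le> \<Theta>_trunc l e n x"
    unfolding \<Theta>_trunc_def
  proof (rule SUP_mono)
    fix i assume "i \<in> {..m}"
    have "min (U (e i)) (of_nat m) \<le> min (U (e i)) (of_nat n)"
      using mn by (intro min.mono) auto
    then show "\<exists>j\<in>{..n}. (if c x (e i) \<le> real m then min (U (e i)) (of_nat m) - ennreal (l * c x (e i)) else 0)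
       \<le> (if c x (e j) \<le> real n then min (U (e j)) (of_nat n) - ennreal (l * c x (e j)) else 0)"
      using mn \<open>i \<in> {..m}\<close> by (intro bexI[of _ i]) (auto intro: ennreal_minus_mono)
  qed
qed

text \<open>For a fixed index \<open>i\<close>, the limits on the index and on the cost are inactive
  for large \<open>n\<close>, and the cap on the value disappears in the limit.\<close>

lemma SUP_\<Theta>_trunc:
  "(SUP i. U (e i) - ennreal (l * c x (e i))) \<le> (SUP n. \<Theta>_trunc l e n x)"
proof (rule SUP_least)
  fix i
  let ?y = "SUP n. \<Theta>_trunc l e n x" and ?b = "ennreal (l * c x (e i))"
  obtain n0 :: nat where n0: "c x (e i) \<le> real n0" using real_arch_simple by blast
  have step: "min (U (e i)) (of_nat n) \<le> ?b + ?y" if "max i n0 \<le> n" for n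
  proof -
    have "min (U (e i)) (of_nat n) - ?b \<le> \<Theta>_trunc l e n x"
      unfolding \<Theta>_trunc_def using that n0 by (intro SUP_upper2[of i]) auto
    also have "\<dots> \<le> ?y" by (rule SUP_upper) simp
    finally show ?thesis by (simp add: ennreal_minus_le_iff)
  qed
  have "U (e i) \<le> ?b + ?y"
  \<comment> \<open>If the bound is a finite \<open>r\<close>, a cap beyond \<open>r\<close> cannot
    be the smaller argument of the minimum, so \<open>U (e i)\<close> itself is at most
    \<open>r\<close>.\<close>
  proof (cases "?b + ?y")
    case (real r)
    obtain n :: nat where n: "r < real n" using reals_Archimedean2 by blast
    let ?n = "max n (max i n0)"
    have "min (U (e i)) (of_nat ?n) \<le> ennreal r" using step[of ?n] real by simp
    moreover have "ennreal r < of_nat ?n"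
      using n real by (simp add: ennreal_of_nat_eq_real_of_nat ennreal_less_iff)
    ultimately show ?thesis unfolding real(2) by (meson leD min_le_iff_disj)
  qed (simp only: top_greatest)
  then show "U (e i) - ?b \<le> ?y" by (simp add: ennreal_minus_le_iff)
qed

text \<open>If the truncated value is 0, a target of cost below \<open>d\<close> will do, paid for
  by the slack \<open>l * d\<close>. Otherwise the finite maximum is attained at an index of cost at
  most \<open>n\<close>.\<close>

lemma \<Theta>_trunc_selection:
  assumes e: "\<And>s. s \<in> S \<Longrightarrow> (s, U s) \<in> closure (range (\<lambda>i::nat. (e i, U (e i))))"
    and x: "x \<in> S" and d: "0 < d" and l: "0 \<le> l"
  shows "\<exists>i. \<Theta>_trunc l e n x + ennreal (l * c x (e i)) \<le> U (e i) + ennreal (l * d)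
    \<and> c x (e i) \<le> real n + d"
proof (cases "\<Theta>_trunc l e n x = 0")
  case True
  obtain i where i: "c x (e i) < d" using near_point[OF e x d] by blast
  then have "ennreal (l * c x (e i)) \<le> ennreal (l * d)"
    using l by (intro ennreal_leI mult_left_mono) auto
  then show ?thesis using True i by (intro exI[of _ i]) (auto intro: add_increasing)
next
  case False
  let ?g = "\<lambda>i. if c x (e i) \<le> real n then min (U (e i)) (of_nat n) - ennreal (l * c x (e i)) else 0"
  have "\<Theta>_trunc l e n x = Max (?g ` {..n})"
    unfolding \<Theta>_trunc_def by (rule Max_Sup[symmetric]) auto
  also have "\<dots> \<in> ?g ` {..n}" by (rule Max_in) auto
  finally obtain i where i: "\<Theta>_trunc l e n x = ?g i" by blast
  then have c: "c x (e i) \<le> real n"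
    and eq: "\<Theta>_trunc l e n x = min (U (e i)) (of_nat n) - ennreal (l * c x (e i))"
    using False by (auto split: if_splits)
  \<comment> \<open>The difference is nonzero, so the subtraction was not truncated and can be
    undone.\<close>
  have "ennreal (l * c x (e i)) \<le> min (U (e i)) (of_nat n)"
  proof (rule ccontr)
    assume "\<not> ennreal (l * c x (e i)) \<le> min (U (e i)) (of_nat n)"
    then have "min (U (e i)) (of_nat n) \<le> ennreal (l * c x (e i))" using linear by blast
    then have "min (U (e i)) (of_nat n) - ennreal (l * c x (e i)) \<le> 0"
      unfolding ennreal_minus_le_iff
      by (intro conjI impI) (simp_all only: add_0_right ennreal_neq_top simp_thms)
    then show False using False unfolding eq by simp
  qed
  then have "\<Theta>_trunc l e n x + ennreal (l * c x (e i)) = min (U (e i)) (of_nat n)"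
    unfolding eq by (rule diff_add_cancel_ennreal)
  then show ?thesis
    using c d by (intro exI[of _ i]) (auto intro: add_increasing2 order.trans[OF min.cobounded1])
qed

text \<open>The multiplier is a supergradient at \<open>\<rho>\<close> of the best value as a
  function of the budget. Testing the supporting line on plans that nearly attain
  \<open>\<Theta>_trunc\<close> bounds the truncated dual, and monotone convergence removes the
  truncation.\<close>

lemma strong_duality:
  assumes \<rho>: "0 < \<rho>" and v: "0 \<le> v"
    and bound: "\<And>\<gamma> h. \<gamma> \<in> plans \<Longrightarrow> cost \<gamma> \<le> ennreal \<rho> \<Longrightarrow> h \<in> borel_measurable BS
      \<Longrightarrow> (\<And>s. s \<in> S \<Longrightarrow> h s \<le> U s) \<Longrightarrow> (\<integral>\<^sup>+ z. h (snd z) \<partial>\<gamma>) \<le> ennreal v"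
  obtains l where "0 \<le> l" "ennreal (l * \<rho>) + (\<integral>\<^sup>+ x. \<Theta> l x \<partial>Q) \<le> ennreal v"
proof -
  obtain e :: "nat \<Rightarrow> 's" where e: "range e \<subseteq> S"
    and dense: "\<And>s. s \<in> S \<Longrightarrow> (s, U s) \<in> closure (range (\<lambda>i. (e i, U (e i))))"
    using countable_dense_in_graph[OF S_nonempty] by blast
  \<comment> \<open>A Borel minorant of \<open>U\<close>, since it differs from 0 only on a
    countable set; it agrees with \<open>U\<close> at every target \<open>e i\<close> used by a
    selection.\<close>
  define h where "h s = (if s \<in> range e then U s else 0)" for s
  have h_eq: "h (e i) = U (e i)" for i by (simp add: h_def)
  have h_le: "h s \<le> U s" for s by (simp add: h_def)
  have h[measurable]: "h \<in> borel_measurable BS"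
  proof (rule measurable_restrict_space1)
    have "h \<in> borel_measurable (borel :: 's measure)"
      unfolding h_def
      by (rule measurable_discrete_difference[where f="\<lambda>_. 0" and X="range e"]) auto
    then show "h \<in> borel_measurable borel" .
  qed
  let ?val = "\<lambda>\<gamma>. \<integral>\<^sup>+ z. h (snd z) \<partial>\<gamma>"
  \<comment> \<open>Pairs of a budget and a value achievable within it; budgets may be raised and
    values lowered.\<close>
  define R where "R = {(r, x). 0 \<le> r \<and> 0 \<le> x \<and>
    (\<exists>\<gamma>\<in>plans. cost \<gamma> \<le> ennreal r \<and> ennreal x \<le> ?val \<gamma>)}"
  have conv: "convex R"
  proof (rule convexI)
    fix y1 y2 :: "real \<times> real" and a b :: real
    assume y: "y1 \<in> R" "y2 \<in> R" and ab: "0 \<le> a" "0 \<le> b" "a + b = 1"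
    obtain r1 x1 where y1: "y1 = (r1, x1)" by fastforce
    obtain r2 x2 where y2: "y2 = (r2, x2)" by fastforce
    obtain \<gamma>1 where 1: "0 \<le> r1" "0 \<le> x1" "\<gamma>1 \<in> plans" "cost \<gamma>1 \<le> ennreal r1" "ennreal x1 \<le> ?val \<gamma>1"
      using y(1) unfolding R_def y1 by auto
    obtain \<gamma>2 where 2: "0 \<le> r2" "0 \<le> x2" "\<gamma>2 \<in> plans" "cost \<gamma>2 \<le> ennreal r2" "ennreal x2 \<le> ?val \<gamma>2"
      using y(2) unfolding R_def y2 by auto
    obtain \<gamma> where \<gamma>: "\<gamma> \<in> plans" and int: "\<And>f. f \<in> borel_measurable (BS \<Otimes>\<^sub>M BS) \<Longrightarrow>
      (\<integral>\<^sup>+ z. f z \<partial>\<gamma>) = ennreal a * (\<integral>\<^sup>+ z. f z \<partial>\<gamma>1) + ennreal b * (\<integral>\<^sup>+ z. f z \<partial>\<gamma>2)"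
      using mixture_plan[OF 1(3) 2(3) ab] by blast
    have "cost \<gamma> = ennreal a * cost \<gamma>1 + ennreal b * cost \<gamma>2"
      unfolding cost_def case_prod_beta by (rule int) measurable
    also have "\<dots> \<le> ennreal a * ennreal r1 + ennreal b * ennreal r2"
      using 1 2 by (intro add_mono mult_left_mono) auto
    also have "\<dots> = ennreal (a * r1 + b * r2)"
      using 1 2 ab by (simp add: ennreal_mult)
    finally have "cost \<gamma> \<le> ennreal (a * r1 + b * r2)" .
    moreover have "ennreal (a * x1 + b * x2) = ennreal a * ennreal x1 + ennreal b * ennreal x2"
      using 1 2 ab by (simp add: ennreal_mult)
    moreover have "\<dots> \<le> ennreal a * ?val \<gamma>1 + ennreal b * ?val \<gamma>2"
      using 1 2 by (intro add_mono mult_left_mono) auto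
    moreover have "\<dots> = ?val \<gamma>" by (rule int[symmetric]) measurable
    ultimately show "a *\<^sub>R y1 + b *\<^sub>R y2 \<in> R"
      unfolding R_def y1 y2 using \<gamma> 1 2 ab by auto
  qed
  \<comment> \<open>With zero integrand and zero multiplier, the selection merely produces a plan of
    cost at most \<open>\<rho> / 2\<close>, strictly inside the budget.\<close>
  have "\<exists>i. (0::ennreal) + ennreal (0 * c x (e i)) \<le> h (e i) + ennreal 0 \<and> c x (e i) \<le> \<rho> / 2"
    if "x \<in> S" for x
    using near_point[OF dense that, of "\<rho> / 2"] \<rho> by (auto intro: less_imp_le)
  then obtain \<gamma>0 where "\<gamma>0 \<in> plans" "cost \<gamma>0 \<le> ennreal (\<rho> / 2)"
    using deterministic_plan[OF e _ h, of "\<lambda>_. 0" 0 0 "\<rho> / 2"] by auto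
  then have slater: "(\<rho> / 2, 0) \<in> R" using \<rho> by (auto simp: R_def)
  have Rv: "x \<le> v" if rx: "(r, x) \<in> R" "r \<le> \<rho>" for r x
  proof -
    obtain \<gamma> where \<gamma>: "\<gamma> \<in> plans" "cost \<gamma> \<le> ennreal r" "ennreal x \<le> ?val \<gamma>"
      using rx(1) unfolding R_def by auto
    have "?val \<gamma> \<le> ennreal v"
      using \<gamma> rx(2) by (intro bound h h_le) (auto intro: order.trans[OF _ ennreal_leI])
    with \<gamma>(3) have "ennreal x \<le> ennreal v" by (rule order.trans)
    then show ?thesis using v by simp
  qed
  obtain l where l: "0 \<le> l" "\<And>r x. (r, x) \<in> R \<Longrightarrow> x - l * r \<le> v - l * \<rho>"
  proof (rule supergradient_exists[OF conv slater])
    show "\<rho> / 2 < \<rho>" using \<rho> by simp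
  qed (use Rv in blast)+
  have trunc: "(\<integral>\<^sup>+ x. \<Theta>_trunc l e n x \<partial>Q) + ennreal (l * \<rho>) \<le> ennreal v" for n
  proof -
    let ?I = "\<integral>\<^sup>+ x. \<Theta>_trunc l e n x \<partial>Q"
    have "?I \<le> (\<integral>\<^sup>+ x. of_nat n \<partial>Q)" by (intro nn_integral_mono \<Theta>_trunc_le)
    then have "?I \<le> ennreal (real n)" by (simp add: Q.emeasure_space_1 ennreal_of_nat_eq_real_of_nat)
    then obtain I where I: "?I = ennreal I" "0 \<le> I" by (cases ?I) (auto simp: top_unique)
    have "I - l * d \<le> v - l * \<rho>" if d: "0 < d" for d
    proof -
      obtain \<gamma> where \<gamma>: "\<gamma> \<in> plans" "cost \<gamma> \<le> ennreal (real n + d)"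
        "?I + ennreal l * cost \<gamma> \<le> ?val \<gamma> + ennreal (l * d)"
      proof (rule deterministic_plan[OF e _ h, of "\<Theta>_trunc l e n" l "l * d" "real n + d"])
        show "\<exists>i. \<Theta>_trunc l e n x + ennreal (l * c x (e i)) \<le> h (e i) + ennreal (l * d)
          \<and> c x (e i) \<le> real n + d" if "x \<in> S" for x
          unfolding h_eq by (rule \<Theta>_trunc_selection[OF dense that d l(1)])
      qed (use l in auto)
      obtain r where r: "cost \<gamma> = ennreal r" "0 \<le> r"
        using \<gamma>(2) by (cases "cost \<gamma>") (auto simp: top_unique)
      have le: "ennreal (I + l * r) \<le> ?val \<gamma> + ennreal (l * d)"
        using \<gamma>(3) unfolding I r using I(2) r(2) l(1) by (simp add: ennreal_mult)
      \<comment> \<open>The maximum keeps the value nonnegative, as \<open>R\<close> demands. In the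
        supporting inequality at \<open>(r, ?x)\<close> the terms \<open>l * r\<close>
        cancel.\<close>
      let ?x = "max 0 (I + l * r - l * d)"
      have "ennreal ?x \<le> ?val \<gamma>"
      proof (cases "?val \<gamma>")
        case (real w)
        then show ?thesis using le l(1) d by (simp flip: ennreal_plus)
      qed simp
      then have "(r, ?x) \<in> R"
        unfolding R_def using \<gamma>(1) r by (auto intro!: bexI[of _ \<gamma>])
      from l(2)[OF this] show ?thesis by linarith
    qed note * = this
    have "I \<le> v - l * \<rho>"
    proof (rule field_le_epsilon)
      fix \<epsilon> :: real assume \<epsilon>: "0 < \<epsilon>"
      \<comment> \<open>The denominator \<open>l + 1\<close> also covers
        \<open>l = 0\<close>.\<close>
      have "l * (\<epsilon> / (l + 1)) \<le> \<epsilon>" using l(1) \<epsilon> by (simp add: field_simps)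
      then show "I \<le> v - l * \<rho> + \<epsilon>" using *[of "\<epsilon> / (l + 1)"] \<epsilon> l(1) by simp
    qed
    then have "ennreal (I + l * \<rho>) \<le> ennreal (v)" by (intro ennreal_leI) simp
    then show ?thesis using I l(1) \<rho> by simp
  qed
  have "\<Theta> l x \<le> (SUP n. \<Theta>_trunc l e n x)" for x
    using SUP_\<Theta>_trunc[of e l x] \<Theta>_eq_SUP_dense[OF e dense, of l x] by simp
  then have "(\<integral>\<^sup>+ x. \<Theta> l x \<partial>Q) \<le> (\<integral>\<^sup>+ x. (SUP n. \<Theta>_trunc l e n x) \<partial>Q)"
    by (simp add: nn_integral_mono)
  also have "\<dots> = (SUP n. \<integral>\<^sup>+ x. \<Theta>_trunc l e n x \<partial>Q)"
    by (rule nn_integral_monotone_convergence_SUP[OF \<Theta>_trunc_mono]) measurable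
  finally have "ennreal (l * \<rho>) + (\<integral>\<^sup>+ x. \<Theta> l x \<partial>Q)
      \<le> (SUP n. \<integral>\<^sup>+ x. \<Theta>_trunc l e n x \<partial>Q) + ennreal (l * \<rho>)"
    by (simp add: add.commute add_mono)
  also have "\<dots> = (SUP n. (\<integral>\<^sup>+ x. \<Theta>_trunc l e n x \<partial>Q) + ennreal (l * \<rho>))"
    by (simp add: ennreal_SUP_add_left)
  also have "\<dots> \<le> ennreal v" using trunc by (rule SUP_least)
  finally show ?thesis using l(1) that by blast
qed

end

subsection \<open>Transport duality for extended real functions bounded from below\<close>

text \<open>For finite \<open>a\<close>, subtract \<open>a\<close> again; for
  \<open>a = \<infinity>\<close>, the uniform bound \<open>m\<close> keeps the infimum away from
  \<open>-\<infinity>\<close>, so both sides are infinite.\<close>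

lemma ereal_add_INF:
  fixes f :: "'i \<Rightarrow> ereal"
  assumes "I \<noteq> {}" "a \<noteq> -\<infinity>" and f: "\<And>i. i \<in> I \<Longrightarrow> ereal m \<le> f i"
  shows "a + (INF i\<in>I. f i) = (INF i\<in>I. a + f i)"
proof (cases a)
  case (real b)
  show ?thesis
  proof (rule antisym)
    show "a + (INF i\<in>I. f i) \<le> (INF i\<in>I. a + f i)"
      by (intro INF_greatest add_left_mono INF_lower)
    have "(INF i\<in>I. a + f i) - a \<le> (INF i\<in>I. f i)"
    proof (rule INF_greatest)
      fix i assume "i \<in> I"
      then have "(INF i\<in>I. a + f i) \<le> a + f i" by (rule INF_lower)
      then show "(INF i\<in>I. a + f i) - a \<le> f i"
        by (simp add: real ereal_minus_le add.commute)
    qed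
    then show "(INF i\<in>I. a + f i) \<le> a + (INF i\<in>I. f i)"
      by (simp add: real ereal_minus_le add.commute)
  qed
next
  case PInf
  have "ereal m \<le> (INF i\<in>I. f i)" using f by (rule INF_greatest)
  then have "(INF i\<in>I. f i) \<noteq> -\<infinity>" by auto
  moreover have "a + f i = \<infinity>" if "i \<in> I" for i using f[OF that] PInf by auto
  ultimately show ?thesis using PInf assms(1) by simp
qed (use assms in simp)

locale transport_shifted = transport S Q c "\<lambda>s. e2ennreal (V s + ereal k)"
  for S :: "'s::{second_countable_topology, t2_space} set"
    and Q :: "'s measure" and c :: "'s \<Rightarrow> 's \<Rightarrow> real"
    and V :: "'s \<Rightarrow> ereal" and k :: real +
  assumes k_nonneg: "0 \<le> k" and V_ge: "\<And>s. s \<in> S \<Longrightarrow> ereal (- k) \<le> V s"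
begin

abbreviation U :: "'s \<Rightarrow> ennreal" where "U s \<equiv> e2ennreal (V s + ereal k)"

abbreviation \<Phi> :: "real \<Rightarrow> 's \<Rightarrow> ereal" where
  "\<Phi> l x \<equiv> (SUP s\<in>S. V s - ereal (l * c x s))"

lemma V_eq: "s \<in> S \<Longrightarrow> V s = enn2ereal (U s) - ereal k"
  using V_ge[of s] by (cases "V s") (auto simp: enn2ereal_e2ennreal)

lemma V_le_enn2ereal:
  assumes "s \<in> S" "U s \<le> w"
  shows "V s \<le> enn2ereal w - ereal k"
  using assms(2) unfolding less_eq_ennreal.rep_eq
  by (subst V_eq[OF assms(1)], intro ereal_minus_mono) simp_all

lemma enn2ereal_le_V:
  assumes "s \<in> S" "w \<le> U s"
  shows "enn2ereal w - ereal k \<le> V s"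
  using assms(2) unfolding less_eq_ennreal.rep_eq
  by (subst V_eq[OF assms(1)], intro ereal_minus_mono) simp_all

lemma minus_cost_eq:
  assumes "s \<in> S" "0 \<le> l"
  shows "e2ennreal (V s - ereal (l * c x s) + ereal k) = U s - ennreal (l * c x s)"
proof -
  have "0 \<le> l * c x s" using assms c_nonneg by simp
  then show ?thesis
    using V_ge[OF assms(1)]
    by (cases "V s") (auto simp: ennreal_minus algebra_simps infinity_ennreal_def)
qed

lemma \<Phi>_eq:
  assumes x: "x \<in> S" and l: "0 \<le> l"
  shows "\<Phi> l x = enn2ereal (\<Theta> l x) - ereal k"
proof -
  \<comment> \<open>Staying at \<open>x\<close> costs nothing. The resulting lower bound lets the
    shift by \<open>k\<close> be inverted at the end.\<close>
  have "V x \<le> \<Phi> l x"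
    using SUP_upper[of x S "\<lambda>s. V s - ereal (l * c x s)"] x c_refl by simp
  then have ge: "ereal (- k) \<le> \<Phi> l x" using V_ge[OF x] by (rule order.trans[rotated])
  have "\<Theta> l x = e2ennreal (\<Phi> l x + ereal k)"
  proof (rule antisym)
    show "\<Theta> l x \<le> e2ennreal (\<Phi> l x + ereal k)"
      unfolding \<Theta>_def
    proof (rule SUP_least)
      fix s assume "s \<in> S"
      then show "U s - ennreal (l * c x s) \<le> e2ennreal (\<Phi> l x + ereal k)"
        unfolding minus_cost_eq[OF \<open>s \<in> S\<close> l, symmetric]
        by (intro e2ennreal_mono add_right_mono SUP_upper)
    qed
    have "\<Phi> l x \<le> enn2ereal (\<Theta> l x) - ereal k"
    proof (rule SUP_least)
      fix s assume s: "s \<in> S"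
      have "U s - ennreal (l * c x s) \<le> \<Theta> l x" unfolding \<Theta>_def using s by (rule SUP_upper)
      then have "e2ennreal (V s - ereal (l * c x s) + ereal k) \<le> \<Theta> l x"
        unfolding minus_cost_eq[OF s l] .
      then have "enn2ereal (e2ennreal (V s - ereal (l * c x s) + ereal k)) \<le> enn2ereal (\<Theta> l x)"
        by (simp flip: less_eq_ennreal.rep_eq)
      moreover have "y \<le> enn2ereal (e2ennreal y)" for y
        by (cases "0 \<le> y") (auto simp: enn2ereal_e2ennreal intro: order.trans[OF _ enn2ereal_nonneg])
      ultimately have "V s - ereal (l * c x s) + ereal k \<le> enn2ereal (\<Theta> l x)"
        using order.trans by blast
      then show "V s - ereal (l * c x s) \<le> enn2ereal (\<Theta> l x) - ereal k"
        by (simp add: ereal_le_minus)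
    qed
    then have "\<Phi> l x + ereal k \<le> enn2ereal (\<Theta> l x)" by (simp add: ereal_le_minus)
    then show "e2ennreal (\<Phi> l x + ereal k) \<le> \<Theta> l x"
      by (metis e2ennreal_enn2ereal e2ennreal_mono)
  qed
  then show ?thesis using ge by (cases "\<Phi> l x") (auto simp: enn2ereal_e2ennreal)
qed

lemma expect_\<Phi>:
  assumes "0 \<le> l"
  shows "expect Q (\<Phi> l) = enn2ereal (\<integral>\<^sup>+ x. \<Theta> l x \<partial>Q) - ereal k"
proof -
  have "expect Q (\<Phi> l) = expect Q (\<lambda>x. enn2ereal (\<Theta> l x) - ereal k)"
    by (rule expect_cong) (simp add: \<Phi>_eq assms space_Q)
  also have "\<dots> = enn2ereal (\<integral>\<^sup>+ x. \<Theta> l x \<partial>Q) - ereal k"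
    by (rule expect_enn2ereal_minus[OF prob_Q _ k_nonneg]) measurable
  finally show ?thesis .
qed

lemma expect_\<Phi>_ge: "0 \<le> l \<Longrightarrow> ereal (- k) \<le> expect Q (\<Phi> l)"
  by (simp add: expect_\<Phi> ereal_le_minus flip: zero_ereal_def)

text \<open>\<open>V\<close> is reached only through Borel functions on either side: minorants here,
  majorants in \<open>expect_V_le\<close>.\<close>

lemma expect_V_ge:
  assumes P: "P \<in> borel_probs S" and h: "h \<in> borel_measurable BS" "\<And>s. s \<in> S \<Longrightarrow> h s \<le> U s"
  shows "enn2ereal (\<integral>\<^sup>+ s. h s \<partial>P) - ereal k \<le> expect P V"
proof -
  have [measurable_cong]: "sets P = sets BS" and "prob_space P"
    using P by (auto simp: borel_probs_def)
  then have "enn2ereal (\<integral>\<^sup>+ s. h s \<partial>P) - ereal k = expect P (\<lambda>s. enn2ereal (h s) - ereal k)"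
    using h(1) k_nonneg by (intro expect_enn2ereal_minus[symmetric]) auto
  also have "\<dots> \<le> expect P V"
    using h(2) by (intro expect_mono) (simp add: space_borel_probs[OF P] enn2ereal_le_V)
  finally show ?thesis .
qed

lemma expect_V_le:
  assumes P: "P \<in> borel_probs S" and W: "W \<in> borel_measurable P" "\<And>s. s \<in> S \<Longrightarrow> U s \<le> W s"
  shows "expect P V \<le> enn2ereal (\<integral>\<^sup>+ s. W s \<partial>P) - ereal k"
proof -
  have "expect P V \<le> expect P (\<lambda>s. enn2ereal (W s) - ereal k)"
    using W(2) by (intro expect_mono) (simp add: space_borel_probs[OF P] V_le_enn2ereal)
  also have "\<dots> = enn2ereal (\<integral>\<^sup>+ s. W s \<partial>P) - ereal k"
    using W(1) k_nonneg P by (intro expect_enn2ereal_minus) (auto simp: borel_probs_def)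
  finally show ?thesis .
qed

section \<open>Feasible target measures\<close>

lemma Q_borel_probs: "Q \<in> borel_probs S"
  using prob_Q sets_Q by (simp add: borel_probs_def)

text \<open>The diagonal coupling is free, so the reference measure lies in its own ambiguity
  set.\<close>

lemma kantorovich_cost_self: "kantorovich_cost S c Q Q = 0"
proof -
  let ?m = "\<lambda>x. (x, x)" and ?\<gamma> = "distr Q (BS \<Otimes>\<^sub>M BS) (\<lambda>x. (x, x))"
  have m: "?m \<in> Q \<rightarrow>\<^sub>M BS \<Otimes>\<^sub>M BS" by measurable
  have "distr ?\<gamma> BS fst = Q" "distr ?\<gamma> BS snd = Q"
    by (subst distr_distr; simp add: comp_def distr_id2 sets_Q)+
  then have \<gamma>: "?\<gamma> \<in> couplings S Q Q"
    by (simp add: couplings_def Q.prob_space_distr[OF m])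
  have "kantorovich_cost S c Q Q \<le> (\<integral>\<^sup>+ (x, y). ennreal (c x y) \<partial>?\<gamma>)"
    unfolding kantorovich_cost_def using \<gamma> by (rule INF_lower)
  also have "\<dots> = 0"
    unfolding case_prod_beta by (subst nn_integral_distr) (auto simp: c_refl)
  finally show ?thesis by simp
qed

lemma expect_V_ge_lower_bound: "P \<in> borel_probs S \<Longrightarrow> ereal (- k) \<le> expect P V"
  using expect_V_ge[of P "\<lambda>_. 0"] by (simp add: zero_ennreal.rep_eq)

lemma plan_marginal:
  assumes \<gamma>: "\<gamma> \<in> plans"
  shows "distr \<gamma> BS snd \<in> borel_probs S" "kantorovich_cost S c Q (distr \<gamma> BS snd) \<le> cost \<gamma>"
    "h \<in> borel_measurable BS \<Longrightarrow> (\<integral>\<^sup>+ s. h s \<partial>distr \<gamma> BS snd) = (\<integral>\<^sup>+ z. h (snd z) \<partial>\<gamma>)"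
proof -
  have [measurable_cong]: "sets \<gamma> = sets (BS \<Otimes>\<^sub>M BS)" and pr: "prob_space \<gamma>"
    using \<gamma> by (auto simp: plans_def)
  have snd: "snd \<in> \<gamma> \<rightarrow>\<^sub>M BS" by measurable
  show "distr \<gamma> BS snd \<in> borel_probs S"
    using prob_space.prob_space_distr[OF pr snd] by (simp add: borel_probs_def)
  have "\<gamma> \<in> couplings S Q (distr \<gamma> BS snd)"
    using \<gamma> by (auto simp: couplings_def plans_def)
  then show "kantorovich_cost S c Q (distr \<gamma> BS snd) \<le> cost \<gamma>"
    unfolding kantorovich_cost_def cost_def by (rule INF_lower)
  show "h \<in> borel_measurable BS \<Longrightarrow> (\<integral>\<^sup>+ s. h s \<partial>distr \<gamma> BS snd) = (\<integral>\<^sup>+ z. h (snd z) \<partial>\<gamma>)"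
    by (rule nn_integral_distr[OF snd]) simp
qed

lemma point_mass_borel_probs:
  assumes "s \<in> S"
  shows "return BS s \<in> borel_probs S"
  using assms by (simp add: borel_probs_def prob_space_return space_BS)

text \<open>The function equal to \<open>U s\<close> at \<open>s\<close> and 0 elsewhere is a Borel
  minorant of \<open>U\<close>. Point masses are the test measures for an infinite radius.\<close>

lemma V_le_expect_point_mass:
  assumes s: "s \<in> S"
  shows "V s \<le> expect (return BS s) V"
proof -
  let ?h = "\<lambda>y. if y = s then U s else 0"
  have h: "?h \<in> borel_measurable BS"
    by (rule measurable_restrict_space1,
        rule measurable_discrete_difference[where f="\<lambda>_. 0" and X="{s}"]) auto
  have "(\<integral>\<^sup>+ y. ?h y \<partial>return BS s) = U s"
    using s h by (subst nn_integral_return) (auto simp: space_BS)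
  moreover have "enn2ereal (\<integral>\<^sup>+ y. ?h y \<partial>return BS s) - ereal k \<le> expect (return BS s) V"
    by (rule expect_V_ge[OF point_mass_borel_probs[OF s] h]) simp
  ultimately show ?thesis using V_eq[OF s] by simp
qed

section \<open>The two inequalities of the duality\<close>

lemma expect_V_le_dual:
  assumes P: "P \<in> borel_probs S" and cost_le: "enn2ereal (kantorovich_cost S c Q P) \<le> r"
    and r: "0 < r" and l: "0 \<le> l"
  shows "expect P V \<le> ereal l * r + expect Q (\<Phi> l)"
proof (cases r)
  case (real \<rho>)
  let ?I = "\<integral>\<^sup>+ x. \<Theta> l x \<partial>Q"
  have \<rho>: "0 < \<rho>" using r real by simp
  show ?thesis
  proof (cases ?I)
    case (real I)
    show ?thesis
    proof (rule ereal_le_epsilon2)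
      fix \<epsilon> :: real assume \<epsilon>: "0 < \<epsilon>"
      \<comment> \<open>The infimum over couplings need not be attained; a coupling of cost below
        \<open>\<rho> + \<delta>\<close> loses at most
        \<open>l * \<delta> \<le> \<epsilon>\<close>.\<close>
      define \<delta> where "\<delta> = \<epsilon> / (l + 1)"
      have \<delta>: "0 < \<delta>" "l * \<delta> \<le> \<epsilon>" using l \<epsilon> by (simp_all add: \<delta>_def field_simps)
      have "kantorovich_cost S c Q P \<le> ennreal \<rho>"
        using cost_le \<rho> by (simp add: \<open>r = ereal \<rho>\<close> less_eq_ennreal.rep_eq)
      also have "\<dots> < ennreal (\<rho> + \<delta>)" using \<rho> \<delta> by (intro ennreal_lessI) auto
      finally have "kantorovich_cost S c Q P < ennreal (\<rho> + \<delta>)" .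
      then obtain \<gamma> where \<gamma>: "\<gamma> \<in> couplings S Q P" "cost \<gamma> < ennreal (\<rho> + \<delta>)"
        unfolding kantorovich_cost_def cost_def[symmetric] INF_less_iff by blast
      obtain W where W: "W \<in> borel_measurable P" "\<And>s. s \<in> S \<Longrightarrow> U s \<le> W s"
        "(\<integral>\<^sup>+ s. W s \<partial>P) \<le> ?I + ennreal l * cost \<gamma>"
        using weak_duality[OF \<gamma>(1) l] by blast
      note W(3)
      also have "?I + ennreal l * cost \<gamma> \<le> ennreal I + ennreal l * ennreal (\<rho> + \<delta>)"
        using \<gamma>(2) real by (intro add_mono mult_left_mono) auto
      also have "\<dots> = ennreal (I + l * (\<rho> + \<delta>))"
        using real l \<rho> \<delta> by (simp add: ennreal_mult)
      finally have "enn2ereal (\<integral>\<^sup>+ s. W s \<partial>P) \<le> ereal (I + l * (\<rho> + \<delta>))"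
        using real l \<rho> \<delta> unfolding less_eq_ennreal.rep_eq by (subst (asm) enn2ereal_ennreal) auto
      then have "expect P V \<le> ereal (I + l * (\<rho> + \<delta>)) - ereal k"
        using expect_V_le[OF P W(1,2)] by (meson ereal_minus_mono order.refl order.trans)
      also have "\<dots> \<le> ereal l * r + expect Q (\<Phi> l) + ereal \<epsilon>"
        unfolding expect_\<Phi>[OF l] using real \<delta> \<open>r = ereal \<rho>\<close> by (simp add: algebra_simps)
      finally show "expect P V \<le> ereal l * r + expect Q (\<Phi> l) + ereal \<epsilon>" .
    qed
  qed (simp add: expect_\<Phi>[OF l] real)
next
  case PInf
  show ?thesis
  \<comment> \<open>In \<open>ereal\<close>, \<open>0 * \<infinity> = 0\<close>, so for
    \<open>l = 0\<close> the integral of \<open>\<Theta> 0\<close> must bound \<open>U\<close>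
    everywhere. For \<open>l > 0\<close> the right-hand side is infinite.\<close>
  proof (cases "l = 0")
    case True
    interpret P: prob_space P using P by (simp add: borel_probs_def)
    let ?I = "\<integral>\<^sup>+ x. \<Theta> 0 x \<partial>Q"
    have "U s \<le> ?I" if "s \<in> S" for s
    proof -
      have "(\<integral>\<^sup>+ x. U s \<partial>Q) \<le> ?I"
        unfolding \<Theta>_def using that by (intro nn_integral_mono SUP_upper2[of s]) auto
      then show ?thesis by (simp add: Q.emeasure_space_1)
    qed
    from expect_V_le[OF P _ this] have "expect P V \<le> enn2ereal ?I - ereal k"
      by (simp add: P.emeasure_space_1)
    moreover have "ereal l * r = 0" using True by (simp flip: zero_ereal_def)
    ultimately show ?thesis unfolding expect_\<Phi>[OF l] using True by (simp flip: zero_ereal_def)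
  next
    case False
    then have "ereal l * r = \<infinity>" using l PInf by simp
    then show ?thesis
      unfolding expect_\<Phi>[OF l] by (cases "\<integral>\<^sup>+ x. \<Theta> l x \<partial>Q") auto
  qed
qed (use r in simp)

text \<open>Feasibility of \<open>Q\<close> excludes the primal value \<open>-\<infinity>\<close>,
  and \<open>\<infinity>\<close> is trivial. For a finite value a multiplier comes from
  \<open>strong_duality\<close>, or is 0 when the radius is infinite.\<close>

lemma INF_dual_le_SUP:
  assumes r: "0 < r"
  shows "(INF l\<in>{0..}. ereal l * r + expect Q (\<Phi> l))
    \<le> (SUP P\<in>{P \<in> borel_probs S. enn2ereal (kantorovich_cost S c Q P) \<le> r}. expect P V)"
    (is "?inf \<le> (SUP P\<in>?M. _)")
proof -
  define \<sigma> where "\<sigma> = (SUP P\<in>?M. expect P V)"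
  have \<sigma>_ge: "expect P V \<le> \<sigma>" if "P \<in> ?M" for P
    unfolding \<sigma>_def using that by (rule SUP_upper)
  have "Q \<in> ?M" using Q_borel_probs r by (simp add: kantorovich_cost_self zero_ennreal.rep_eq)
  then have k\<sigma>: "ereal (- k) \<le> \<sigma>"
    using \<sigma>_ge expect_V_ge_lower_bound[OF Q_borel_probs] by (blast intro: order.trans)
  have "?inf \<le> \<sigma>"
  proof (cases \<sigma>)
    case (real v)
    define w where "w = v + k"
    have w: "0 \<le> w" using k\<sigma> real by (simp add: w_def)
    have dual: "?inf \<le> \<sigma>" if l: "0 \<le> l"
      and le: "ereal l * r + enn2ereal (\<integral>\<^sup>+ x. \<Theta> l x \<partial>Q) \<le> ereal w" for l
    proof -
      have "?inf \<le> ereal l * r + expect Q (\<Phi> l)"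
        using l by (intro INF_lower) simp
      also have "\<dots> = ereal l * r + enn2ereal (\<integral>\<^sup>+ x. \<Theta> l x \<partial>Q) - ereal k"
        unfolding expect_\<Phi>[OF l] by (simp add: add_diff_eq_ereal)
      also have "\<dots> \<le> ereal w - ereal k" using le by (rule ereal_minus_mono) simp
      finally show ?thesis by (simp add: w_def real)
    qed
    show ?thesis
    proof (cases r)
      case r_real: (real \<rho>)
      have \<rho>: "0 < \<rho>" using r r_real by simp
      obtain l where l: "0 \<le> l" "ennreal (l * \<rho>) + (\<integral>\<^sup>+ x. \<Theta> l x \<partial>Q) \<le> ennreal w"
      proof (rule strong_duality[OF \<rho> w])
        fix \<gamma> h assume \<gamma>: "\<gamma> \<in> plans" "cost \<gamma> \<le> ennreal \<rho>"
          and h: "h \<in> borel_measurable BS" "\<And>s. s \<in> S \<Longrightarrow> h s \<le> U s"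
        let ?P = "distr \<gamma> BS snd"
        have "kantorovich_cost S c Q ?P \<le> ennreal \<rho>"
          using plan_marginal(2)[OF \<gamma>(1)] \<gamma>(2) by (rule order.trans)
        then have "?P \<in> ?M"
          using plan_marginal(1)[OF \<gamma>(1)] \<rho> by (simp add: r_real less_eq_ennreal.rep_eq)
        from \<sigma>_ge[OF this] have "enn2ereal (\<integral>\<^sup>+ z. h (snd z) \<partial>\<gamma>) - ereal k \<le> ereal v"
          using expect_V_ge[OF plan_marginal(1)[OF \<gamma>(1)] h]
          unfolding plan_marginal(3)[OF \<gamma>(1) h(1)] real by (rule order.trans[rotated])
        then have "enn2ereal (\<integral>\<^sup>+ z. h (snd z) \<partial>\<gamma>) \<le> enn2ereal (ennreal w)"
          using w by (simp add: w_def ereal_minus_le)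
        then show "(\<integral>\<^sup>+ z. h (snd z) \<partial>\<gamma>) \<le> ennreal w" by (simp add: less_eq_ennreal.rep_eq)
      qed blast
      have "enn2ereal (ennreal (l * \<rho>) + (\<integral>\<^sup>+ x. \<Theta> l x \<partial>Q)) \<le> enn2ereal (ennreal w)"
        using l(2) by (simp add: less_eq_ennreal.rep_eq)
      then show ?thesis
        using l(1) \<rho> w by (intro dual[OF l(1)]) (simp add: r_real plus_ennreal.rep_eq)
    next
      case PInf
      \<comment> \<open>With infinite radius every point mass is feasible, so
        \<open>\<sigma>\<close> bounds \<open>V\<close> pointwise and the multiplier 0
        suffices.\<close>
      have "U s \<le> ennreal w" if s: "s \<in> S" for s
      proof -
        have "V s \<le> \<sigma>"
          using V_le_expect_point_mass[OF s] \<sigma>_ge[of "return BS s"] point_mass_borel_probs[OF s] PInf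
          by simp
        then have "V s + ereal k \<le> ereal w" by (cases "V s") (auto simp: real w_def)
        then show ?thesis by (metis e2ennreal_ereal e2ennreal_mono)
      qed
      then have "\<Theta> 0 x \<le> ennreal w" for x unfolding \<Theta>_def by (auto intro: SUP_least)
      then have "(\<integral>\<^sup>+ x. \<Theta> 0 x \<partial>Q) \<le> (\<integral>\<^sup>+ x. ennreal w \<partial>Q)" by (rule nn_integral_mono)
      then have "enn2ereal (\<integral>\<^sup>+ x. \<Theta> 0 x \<partial>Q) \<le> enn2ereal (ennreal w)"
        by (simp add: Q.emeasure_space_1 less_eq_ennreal.rep_eq)
      then show ?thesis using w by (intro dual[of 0]) (simp_all add: zero_ereal_def[symmetric])
    qed (use r in simp)
  qed (use k\<sigma> in auto)
  then show ?thesis unfolding \<sigma>_def .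
qed

theorem kantorovich_duality:
  assumes "0 < r"
  shows "(SUP P\<in>{P \<in> borel_probs S. enn2ereal (kantorovich_cost S c Q P) \<le> r}. expect P V)
    = (INF l\<in>{0..}. ereal l * r + expect Q (\<Phi> l))"
proof (rule antisym[OF _ INF_dual_le_SUP[OF assms]])
  show "(SUP P\<in>{P \<in> borel_probs S. enn2ereal (kantorovich_cost S c Q P) \<le> r}. expect P V)
    \<le> (INF l\<in>{0..}. ereal l * r + expect Q (\<Phi> l))"
    using assms by (intro SUP_least INF_greatest) (auto intro: expect_V_le_dual)
qed

end

section \<open>Application to the dynamic programming recursion\<close>

theorem mainTheorem3:
  fixes S :: "'s::polish_space set"
    and Act :: "'a::polish_space set"
    and A :: "'s \<Rightarrow> 'a set"
    and K :: "('s \<times> 'a) set"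
    and T :: nat
    and g :: "nat \<Rightarrow> 's \<times> 'a \<Rightarrow> ereal"
    and Phat :: "'s \<times> 'a \<Rightarrow> 's measure"
    and \<rho> :: "'s \<times> 'a \<Rightarrow> ereal"
    and p :: real
    and c :: "'s \<Rightarrow> 's \<Rightarrow> real"
    and V :: "nat \<Rightarrow> 's \<Rightarrow> ereal"
  assumes S: "S \<in> sets borel" "S \<noteq> {}"
    and Act: "Act \<in> sets borel" "Act \<noteq> {}"
    and A: "\<And>s. s \<in> S \<Longrightarrow> A s \<subseteq> Act" "\<And>s. s \<in> S \<Longrightarrow> A s \<noteq> {}"
    and K: "K = Sigma S A" "analytic_set K"
    and g_lsa: "\<And>t. t \<in> {1..T} \<Longrightarrow> lower_semianalytic_on K (g t)"
    and g_bdd: "\<And>t. t \<in> {1..T} \<Longrightarrow> \<exists>m::real. \<forall>x\<in>K. ereal m \<le> g t x"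
    and Phat: "Phat \<in> restrict_space borel K \<rightarrow>\<^sub>M prob_algebra (restrict_space borel S)"
    and \<rho>_lsa: "lower_semianalytic_on K \<rho>"
    and \<rho>_pos: "\<And>x. x \<in> K \<Longrightarrow> 0 < \<rho> x"
    and p: "1 \<le> p"
    and c: "c = (\<lambda>s' s. dist s' s powr p)"
    and V_end: "\<And>s. s \<in> S \<Longrightarrow> V (T + 1) s = 0"
    and V_rec: "\<And>t s. t \<in> {1..T} \<Longrightarrow> s \<in> S \<Longrightarrow>
      V t s = (INF a\<in>A s. g t (s, a)
                 + (SUP P\<in>ambiguity_set S c Phat \<rho> (s, a). expect P (V (t + 1))))"
  shows "\<forall>t\<in>{1..T}. \<forall>s\<in>S.
      V t s = (INF (a, l)\<in>A s \<times> {0::real..}. g t (s, a) + ereal l * \<rho> (s, a)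
                 + expect (Phat (s, a)) (\<lambda>s'. SUP s''\<in>S. V (t + 1) s'' - ereal (l * c s' s'')))"
proof -
  have c_cont: "continuous_on UNIV (\<lambda>(x, y). c x y)"
    using p unfolding c case_prod_beta
    by (intro continuous_on_powr' continuous_on_dist continuous_on_fst continuous_on_snd
        continuous_on_id continuous_on_const) auto
  have shifted: "transport_shifted S (Phat x) c W k"
    if "x \<in> K" "0 \<le> k" "\<And>s. s \<in> S \<Longrightarrow> ereal (- k) \<le> W s" for x k W
  proof -
    have "x \<in> space (restrict_space borel K)"
      using that(1) by (simp add: space_restrict_space)
    then have "Phat x \<in> space (prob_algebra (restrict_space borel S))"
      by (rule measurable_space[OF Phat])
    then have "prob_space (Phat x)" "sets (Phat x) = sets (restrict_space borel S)"
      by (auto simp: space_prob_algebra)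
    then have "transport S (Phat x) c"
      using c_cont by (intro transport.intro) (simp_all add: c)
    then show ?thesis
      using that by (intro transport_shifted.intro transport_shifted_axioms.intro)
  qed
  have amb: "ambiguity_set S c Phat \<rho> x =
      {P \<in> borel_probs S. enn2ereal (kantorovich_cost S c (Phat x) P) \<le> \<rho> x}" for x
    by (simp add: ambiguity_set_def)
  \<comment> \<open>Backward induction on the number \<open>n\<close> of stages already processed;
    \<open>n = 0\<close> is the terminal function.\<close>
  have bounded: "\<exists>k\<ge>0. \<forall>s\<in>S. ereal (- k) \<le> V (T + 1 - n) s" if "n \<le> T" for n
    using that
  proof (induction n)
    case 0
    show ?case using V_end by (intro exI[of _ 0]) (simp add: zero_ereal_def[symmetric])
  next
    case (Suc n)
    then obtain k where k: "0 \<le> k" "\<And>s. s \<in> S \<Longrightarrow> ereal (- k) \<le> V (T + 1 - n) s" by auto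
    define t where "t = T + 1 - Suc n"
    have t: "t \<in> {1..T}" "t + 1 = T + 1 - n" using Suc.prems by (auto simp: t_def)
    obtain m where m: "\<And>x. x \<in> K \<Longrightarrow> ereal m \<le> g t x" using g_bdd[OF t(1)] by blast
    have "ereal (- (k + \<bar>m\<bar>)) \<le> V t s" if s: "s \<in> S" for s
      unfolding V_rec[OF t(1) s]
    proof (rule INF_greatest)
      fix a assume "a \<in> A s"
      then have x: "(s, a) \<in> K" using s K(1) by simp
      interpret transport_shifted S "Phat (s, a)" c "V (t + 1)" k
        using shifted[OF x k(1)] k(2) unfolding t(2) .
      \<comment> \<open>The reference measure is feasible, so the inner supremum inherits the lower
        bound of the next value function.\<close>
      have "Phat (s, a) \<in> ambiguity_set S c Phat \<rho> (s, a)"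
        using Q_borel_probs \<rho>_pos[OF x]
        by (simp add: amb kantorovich_cost_self zero_ennreal.rep_eq)
      then have "ereal (- k) \<le> (SUP P\<in>ambiguity_set S c Phat \<rho> (s, a). expect P (V (t + 1)))"
        using expect_V_ge_lower_bound[OF Q_borel_probs] by (rule SUP_upper2)
      with m[OF x] have "ereal m + ereal (- k)
          \<le> g t (s, a) + (SUP P\<in>ambiguity_set S c Phat \<rho> (s, a). expect P (V (t + 1)))"
        by (rule add_mono)
      moreover have "ereal (- (k + \<bar>m\<bar>)) \<le> ereal m + ereal (- k)" by simp
      ultimately show "ereal (- (k + \<bar>m\<bar>))
          \<le> g t (s, a) + (SUP P\<in>ambiguity_set S c Phat \<rho> (s, a). expect P (V (t + 1)))"
        by (rule order.trans[rotated])
    qed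
    then show ?case unfolding t_def using k(1) by (intro exI[of _ "k + \<bar>m\<bar>"]) auto
  qed
  show ?thesis
  proof (intro ballI)
    fix t s assume t: "t \<in> {1..T}" and s: "s \<in> S"
    \<comment> \<open>For \<open>n = T - t\<close> the index \<open>T + 1 - n\<close> is
      \<open>t + 1\<close>.\<close>
    obtain k where k: "0 \<le> k" "\<And>s. s \<in> S \<Longrightarrow> ereal (- k) \<le> V (t + 1) s"
      using bounded[of "T - t"] t by (auto simp: Suc_diff_le)
    obtain m where m: "\<And>x. x \<in> K \<Longrightarrow> ereal m \<le> g t x" using g_bdd[OF t] by blast
    let ?D = "\<lambda>a l. expect (Phat (s, a)) (\<lambda>s'. SUP s''\<in>S. V (t + 1) s'' - ereal (l * c s' s''))"
    have "g t (s, a) + (SUP P\<in>ambiguity_set S c Phat \<rho> (s, a). expect P (V (t + 1)))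
      = (INF l\<in>{0..}. g t (s, a) + ereal l * \<rho> (s, a) + ?D a l)" if "a \<in> A s" for a
    proof -
      have x: "(s, a) \<in> K" using s that K(1) by simp
      interpret transport_shifted S "Phat (s, a)" c "V (t + 1)" k
        using x k by (rule shifted)
      have dual: "(SUP P\<in>ambiguity_set S c Phat \<rho> (s, a). expect P (V (t + 1)))
        = (INF l\<in>{0..}. ereal l * \<rho> (s, a) + ?D a l)"
        unfolding amb by (rule kantorovich_duality[OF \<rho>_pos[OF x]])
      \<comment> \<open>A bound uniform in \<open>l\<close>, together with
        \<open>g t (s, a) \<noteq> -\<infinity>\<close>, allows the stage cost to move inside the
        infimum.\<close>
      have "ereal (- k) \<le> ereal l * \<rho> (s, a) + ?D a l" if "l \<in> {0..}" for l
      proof -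
        have "ereal (- k) \<le> ?D a l"
          using that expect_\<Phi>_ge by simp
        moreover have "0 \<le> ereal l * \<rho> (s, a)" using that \<rho>_pos[OF x] by simp
        ultimately show ?thesis using add_mono by fastforce
      qed
      moreover have "g t (s, a) \<noteq> -\<infinity>" using m[OF x] by auto
      ultimately have "g t (s, a) + (INF l\<in>{0..}. ereal l * \<rho> (s, a) + ?D a l)
        = (INF l\<in>{0..}. g t (s, a) + (ereal l * \<rho> (s, a) + ?D a l))"
        by (intro ereal_add_INF) auto
      then show ?thesis unfolding dual by (simp only: add.assoc)
    qed
    then have "V t s = (INF a\<in>A s. INF l\<in>{0..}. g t (s, a) + ereal l * \<rho> (s, a) + ?D a l)"
      unfolding V_rec[OF t s] by (rule INF_cong[OF refl])
    then show "V t s = (INF (a, l)\<in>A s \<times> {0::real..}. g t (s, a) + ereal l * \<rho> (s, a) + ?D a l)"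
      by (simp add: INF_Sigma case_prod_beta)
  qed
qed

end
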